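(* Let $A=(000;0101)$, $B=(000;1212)$, $w_{AB}=AB$ and $w_{BA}=BA$. There is a two-state reading $D$ such that $D(w_{AB})\neq D(w_{BA})$.
   Context: $Q_3$ is the $1$-skeleton (graph) of the three-dimensional cube, with vertex set $V=\{0,1\}^3$ and coordinates numbered $0,1,2$; a vertex is written $b_2b_1b_0$ with $b_i$ the $i$-th coordinate, and two vertices are adjacent iff they differ in exactly one coordinate. The basepoint is $o=000$. A walk is $w=(o;a_1a_2\cdots a_n)$ with $n\ge0$, $a_k\in\{0,1,2\}$; its vertex sequence is $v_0=o,v_1,\ldots,v_n$, where $v_k$ is obtained from $v_{k-1}$ by flipping coordinate $a_k$; its $k$-th directed edge is $e_k=(v_{k-1},v_k)$. It is closed if $v_n=o$. Closed walks are concatenated by concatenating step sequences. A sequential reading consists of a state set $S$, an initial state $s_0\in S$, update maps $T_e:S\to S$ for the directed edges $e$ of $Q_3$, a set $Y$, and an output map $q:S\to Y$. Its value on a walk with directed edge sequence $e_1,\ldots,e_n$ is $q\bigl(T_{e_n}\circ\cdots\circ T_{e_1}(s_0)\bigr)$. A $k$-state reading is a sequential reading whose state set has at most $k$ elements. *)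

theory Defs
  imports Main "HOL-Library.FuncSet" "HOL-Library.Numeral_Type"
begin

text \<open>
  Vertices of the cube are functions from the coordinates 0, 1, 2 (the three-element
  numeral type) to bits; \<^term>\<open>True\<close> is the bit 1.
\<close>

type_synonym vertex = "3 \<Rightarrow> bool"
type_synonym edge = "vertex \<times> vertex"

definition origin :: vertex where
  "origin = (\<lambda>_. False)"

definition Q3_edges :: "edge set" where
  "Q3_edges = {(u, v). \<exists>!i. u i \<noteq> v i}"

definition flip :: "3 \<Rightarrow> vertex \<Rightarrow> vertex" where
  "flip a v = v(a := \<not> v a)"

text \<open>
  All walks start at the origin, so a walk is given by its list of steps, and
  concatenation of closed walks is list append.
\<close>

type_synonym walk = "3 list"

primrec vertices_from :: "vertex \<Rightarrow> 3 list \<Rightarrow> vertex list" where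
  "vertices_from v [] = [v]"
| "vertices_from v (a # as) = v # vertices_from (flip a v) as"

definition walk_vertices :: "walk \<Rightarrow> vertex list" where
  "walk_vertices w = vertices_from origin w"

definition walk_edges :: "walk \<Rightarrow> edge list" where
  "walk_edges w = zip (walk_vertices w) (tl (walk_vertices w))"

definition closed_walk :: "walk \<Rightarrow> bool" where
  "closed_walk w \<longleftrightarrow> last (walk_vertices w) = origin"

text \<open>The update maps matter only on \<^const>\<open>Q3_edges\<close> and on \<open>states\<close>.\<close>

record ('s, 'y) reading =
  states :: "'s set"
  init :: 's
  update :: "edge \<Rightarrow> 's \<Rightarrow> 's"
  outputs :: "'y set"
  out :: "'s \<Rightarrow> 'y"

definition sequential_reading :: "('s, 'y) reading \<Rightarrow> bool" where
  "sequential_reading D \<longleftrightarrow>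
     init D \<in> states D \<and>
     (\<forall>e \<in> Q3_edges. update D e \<in> states D \<rightarrow> states D) \<and>
     out D \<in> states D \<rightarrow> outputs D"

definition state_reading :: "nat \<Rightarrow> ('s, 'y) reading \<Rightarrow> bool" where
  "state_reading k D \<longleftrightarrow>
     sequential_reading D \<and> finite (states D) \<and> card (states D) \<le> k"

text \<open>\<^const>\<open>fold\<close> applies the update of the first edge first.\<close>

definition reading_value :: "('s, 'y) reading \<Rightarrow> walk \<Rightarrow> 'y" where
  "reading_value D w = out D (fold (update D) (walk_edges w) (init D))"

lemma flip_in_Q3_edges: "(v, flip a v) \<in> Q3_edges"
  by (auto simp: Q3_edges_def flip_def)

lemma set_zip_vertices_from:
  "set (zip (vertices_from v as) (tl (vertices_from v as))) \<subseteq> Q3_edges"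
proof (induction as arbitrary: v)
  case (Cons a as)
  then show ?case
    using Cons.IH[of "flip a v"] by (cases as) (auto simp: flip_in_Q3_edges)
qed simp

lemma walk_edges_in_Q3: "set (walk_edges w) \<subseteq> Q3_edges"
  by (simp add: walk_edges_def walk_vertices_def set_zip_vertices_from)

lemma closed_walk_commutator:
  assumes "a \<noteq> b" shows "closed_walk [a, b, a, b]"
  using assms by (auto simp: closed_walk_def walk_vertices_def flip_def origin_def fun_eq_iff)

lemma closed_walk_append:
  assumes "closed_walk v" "closed_walk w" shows "closed_walk (v @ w)"
proof -
  have ne: "vertices_from x as \<noteq> []" for x as by (cases as) auto
  have "last (vertices_from x (as @ bs)) = last (vertices_from (last (vertices_from x as)) bs)"
    for x as bs
    by (induction as arbitrary: x) (auto simp: ne)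
  then show ?thesis using assms by (simp add: closed_walk_def walk_vertices_def)
qed

lemma closed_walk_0101: "closed_walk [0, 1, 0, 1]"
  by (rule closed_walk_commutator) simp

lemma closed_walk_1212: "closed_walk [1, 2, 1, 2]"
  by (rule closed_walk_commutator) simp

end

theory Submission
  imports Defs
begin

text \<open>
  \<open>AB\<close> and \<open>BA\<close> end with different edges: \<open>AB\<close> returns to the origin from \<open>100\<close>,
  \<open>BA\<close> from \<open>010\<close>. A reading with two states can remember one bit of the most recent edge,
  and coordinate 2 of its tail separates these two edges.
\<close>

text \<open>
  The state is coordinate 2 of the tail of the last edge read, with the bits encoded as the
  numbers 0 and 1; the updates ignore the previous state.
\<close>
definition last_tail_reading :: "(nat, nat) reading" where
  "last_tail_reading = \<lparr>states = {0, 1}, init = 0,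
     update = (\<lambda>(u, v) s. of_bool (u 2)), outputs = {0, 1}, out = (\<lambda>s. s)\<rparr>"

lemma state_reading_last_tail: "state_reading 2 last_tail_reading"
  by (auto simp: state_reading_def sequential_reading_def last_tail_reading_def)

theorem theorem5p1:
  fixes A B w_AB w_BA :: walk
  assumes "A = [0, 1, 0, 1]"
    and "B = [1, 2, 1, 2]"
    and "w_AB = A @ B"
    and "w_BA = B @ A"
  shows "\<exists>D :: (nat, nat) reading.
           state_reading 2 D \<and> reading_value D w_AB \<noteq> reading_value D w_BA"
proof -
  have "reading_value last_tail_reading w_AB = 1"
    by (simp add: assms reading_value_def last_tail_reading_def walk_edges_def
        walk_vertices_def flip_def origin_def)
  moreover have "reading_value last_tail_reading w_BA = 0"
    by (simp add: assms reading_value_def last_tail_reading_def walk_edges_def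
        walk_vertices_def flip_def origin_def)
  ultimately show ?thesis
    using state_reading_last_tail by (intro exI[of _ last_tail_reading]) simp
qed

end
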